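(* Let $V=f+g-h$ satisfy the standing assumptions (a)–(e) of the context, let $\lambda\in(0,1/L)$, and let $\{w^k\}$ be any sequence with $w^0\in\mathbb{E}$ and $w^{k+1}\in T^{\lambda}_{\rm PDMC}(w^k)$ for $k\ge0$; let $w^*\in\mathrm{Fix}(T^\lambda_{\rm PDMC})$ be an accumulation point of $\{w^k\}$ (which exists under the standing assumptions). If $\mathrm{Id}-\lambda\nabla f_i$ is nonexpansive over $\mathbb{E}$ for all $i\in I$ and $T^\lambda_{\rm PDMC}$ is single-valued at $w^*$, then $\{w^k\}$ converges to $w^*$ under either one of the following conditions: (i) $\nabla h_m$ is nonexpansive for all $m\in M$ and $g_j$ is $\rho$-convex with $\rho\ge1$ for all $j\in J$; or (ii) $h\equiv0$ and $g_j$ is $\rho$-convex with $\rho\ge0$ for all $j\in J$. Moreover, $Q$-linear convergence to $w^*$ is achieved if $\rho>1$ in case (i) or $\rho>0$ in case (ii).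
   Context: $\mathbb{E}$ is a Euclidean space with inner product $\langle\cdot,\cdot\rangle$ and norm $\|\cdot\|$. A function $q$ is $\rho$-convex ($\rho\in\mathbb{R}$) if $q-\frac{\rho}{2}\|\cdot\|^2$ is convex. $\mathrm{dom}(q)=\{w:q(w)<+\infty\}$. $\mathrm{Id}$ is the identity operator; a single-valued map is nonexpansive if it is $1$-Lipschitz continuous. $\mathrm{Fix}(T)=\{w: w\in T(w)\}$. Standing assumptions: (a) $f=\min_{i\in I}f_i$, $g=\min_{j\in J}g_j$, $h=\max_{m\in M}h_m$ with $I,J,M$ finite index sets. (b) For each $i\in I$, $f_i:\mathbb{E}\to\mathbb{R}$ has $L_i$-Lipschitz continuous gradient in $\mathbb{E}$ for some $L_i>0$; put $L=\max_{i\in I}L_i$. (c) For each $j\in J$, $g_j:\mathbb{E}\to\mathbb{R}\cup\{+\infty\}$ is proper and $\rho$-convex (with common $\rho\in\mathbb{R}$), $\mathrm{dom}(g_j)$ is closed, and $g_j$ is continuous in $\mathrm{dom}(g_j)$. (d) For each $m\in M$, $h_m:\mathbb{E}\to\mathbb{R}$ is a continuously differentiable convex function. (e) For all $(i,j,m)\in I\times J\times M$, $f_i+g_j-h_m$ is coercive over $\mathbb{E}$. Operator: $D_i(f)=\{w\in\mathbb{E}: f(w)=f_i(w)\}$, $D_m(h)=\{w\in\mathbb{E}: h(w)=h_m(w)\}$, $f'(w)=\{\nabla f_i(w): i\in I,\ w\in D_i(f)\}$, $h'(w)=\{\nabla h_m(w): m\in M,\ w\in D_m(h)\}$, $\mathrm{prox}_{\lambda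 g}(w)=\arg\min_{z\in\mathbb{E}}\{g(z)+\frac{1}{2\lambda}\|z-w\|^2\}$ (possibly set-valued), and $$T^\lambda_{\rm PDMC}(w)=\mathrm{prox}_{\lambda g}\big(w-\lambda f'(w)+\lambda h'(w)\big)=\bigcup_{u\in f'(w),\,v\in h'(w)}\mathrm{prox}_{\lambda g}(w-\lambda u+\lambda v).$$ $Q$-linear convergence to $w^*$ means there is $\kappa\in[0,1)$ with $\|w^{k+1}-w^*\|\le\kappa\|w^k-w^*\|$ for all sufficiently large $k$. *)

theory Defs
  imports "HOL-Analysis.Analysis"
begin

text \<open>
  Functions with values in the reals extended by \<open>+\<infinity>\<close> are rendered as functions into \<^typ>\<open>ereal\<close>
  that avoid \<open>-\<infinity>\<close>; the latter is part of \<open>proper\<close>.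
\<close>

definition effective_domain :: "('a \<Rightarrow> ereal) \<Rightarrow> 'a set" where
  "effective_domain q = {w. q w < \<infinity>}"

definition proper :: "('a \<Rightarrow> ereal) \<Rightarrow> bool" where
  "proper q \<longleftrightarrow> (\<forall>w. q w \<noteq> -\<infinity>) \<and> effective_domain q \<noteq> {}"

text \<open>Meant for functions avoiding \<open>-\<infinity>\<close>; at the endpoints \<open>t = 0, 1\<close> the convention \<open>0 * \<infinity> = 0\<close>
  makes the inequality trivial.\<close>

definition ereal_convex :: "('a::real_vector \<Rightarrow> ereal) \<Rightarrow> bool" where
  "ereal_convex q \<longleftrightarrow>
     (\<forall>x y. \<forall>t\<in>{0..1::real}.
        q ((1 - t) *\<^sub>R x + t *\<^sub>R y) \<le> ereal (1 - t) * q x + ereal t * q y)"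

definition rho_convex :: "real \<Rightarrow> ('a::real_inner \<Rightarrow> ereal) \<Rightarrow> bool" where
  "rho_convex \<rho> q \<longleftrightarrow> ereal_convex (\<lambda>w. q w - ereal (\<rho> / 2 * (norm w)\<^sup>2))"

definition coercive :: "('a::real_normed_vector \<Rightarrow> ereal) \<Rightarrow> bool" where
  "coercive q \<longleftrightarrow> (q \<longlongrightarrow> \<infinity>) at_infinity"

text \<open>Unspecified where \<open>f\<close> is not differentiable.\<close>

definition grad :: "('a::real_inner \<Rightarrow> real) \<Rightarrow> 'a \<Rightarrow> 'a" where
  "grad f w = (THE D. GDERIV f w :> D)"

definition min_fun :: "'i set \<Rightarrow> ('i \<Rightarrow> 'a \<Rightarrow> 'b::linorder) \<Rightarrow> 'a \<Rightarrow> 'b" where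
  "min_fun I q w = (MIN i\<in>I. q i w)"

definition max_fun :: "'i set \<Rightarrow> ('i \<Rightarrow> 'a \<Rightarrow> 'b::linorder) \<Rightarrow> 'a \<Rightarrow> 'b" where
  "max_fun I q w = (MAX i\<in>I. q i w)"

text \<open>\<open>active_set F q i\<close> is the set usually written \<open>D\<^sub>i(F)\<close> when \<open>F\<close> is the pointwise minimum or
  maximum of the family \<open>q\<close>; \<open>active_grads I F q w\<close> is then \<open>F'(w)\<close>.\<close>

definition active_set :: "('a \<Rightarrow> real) \<Rightarrow> ('i \<Rightarrow> 'a \<Rightarrow> real) \<Rightarrow> 'i \<Rightarrow> 'a set" where
  "active_set F q i = {w. F w = q i w}"

definition active_grads ::
  "'i set \<Rightarrow> ('a::real_inner \<Rightarrow> real) \<Rightarrow> ('i \<Rightarrow> 'a \<Rightarrow> real) \<Rightarrow> 'a \<Rightarrow> 'a set" where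
  "active_grads I F q w = {grad (q i) w | i. i \<in> I \<and> w \<in> active_set F q i}"

definition prox :: "real \<Rightarrow> ('a::real_inner \<Rightarrow> ereal) \<Rightarrow> 'a \<Rightarrow> 'a set" where
  "prox lam q w =
     {z. is_arg_min (\<lambda>z. q z + ereal (1 / (2 * lam) * (norm (z - w))\<^sup>2)) (\<lambda>_. True) z}"

definition T_PDMC ::
  "real \<Rightarrow> 'i set \<Rightarrow> ('i \<Rightarrow> 'a::real_inner \<Rightarrow> real) \<Rightarrow> 'j set \<Rightarrow> ('j \<Rightarrow> 'a \<Rightarrow> ereal) \<Rightarrow>
   'm set \<Rightarrow> ('m \<Rightarrow> 'a \<Rightarrow> real) \<Rightarrow> 'a \<Rightarrow> 'a set" where
  "T_PDMC lam I f J g M h w =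
     (\<Union>u\<in>active_grads I (min_fun I f) f w. \<Union>v\<in>active_grads M (max_fun M h) h w.
        prox lam (min_fun J g) (w - lam *\<^sub>R u + lam *\<^sub>R v))"

definition Fix :: "('a \<Rightarrow> 'a set) \<Rightarrow> 'a set" where
  "Fix T = {w. w \<in> T w}"

definition accumulation_point :: "(nat \<Rightarrow> 'a::metric_space) \<Rightarrow> 'a \<Rightarrow> bool" where
  "accumulation_point w p \<longleftrightarrow> (\<exists>r::nat \<Rightarrow> nat. strict_mono r \<and> (w \<circ> r) \<longlonglongrightarrow> p)"

definition nonexpansive :: "('a::metric_space \<Rightarrow> 'a) \<Rightarrow> bool" where
  "nonexpansive F \<longleftrightarrow> 1-lipschitz_on UNIV F"

definition Q_linear_convergence :: "(nat \<Rightarrow> 'a::real_normed_vector) \<Rightarrow> 'a \<Rightarrow> bool" where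
  "Q_linear_convergence w p \<longleftrightarrow>
     (\<exists>\<kappa>. 0 \<le> \<kappa> \<and> \<kappa> < 1 \<and>
        (\<forall>\<^sub>F k in sequentially. norm (w (Suc k) - p) \<le> \<kappa> * norm (w k - p)))"

end

theory Submission
  imports Defs
begin

text \<open>
  With \<open>i\<close>, \<open>j\<close>, \<open>m\<close> active, a step \<open>x \<mapsto> z\<close> is \<open>z = prox lam (g j) (x - lam \<nabla>f i x + lam \<nabla>h m x)\<close>.
  Existence: \<open>f + g - h\<close> decreases by at least a multiple of \<open>(norm (z - x))\<^sup>2\<close> along a step, since
  \<open>lam < 1 / L\<close>; by coercivity the iterates are bounded, so the objective converges, consecutive
  iterates approach each other, and along a subsequence with constant indices the step relation
  passes to the limit.
  Convergence: \<open>prox lam (g j)\<close> is Lipschitz with constant \<open>1 / (1 + lam * \<rho>)\<close>, so two steps with the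
  same indices contract. The indices of a step from a point near \<open>p\<close> are active for
  \<open>p \<mapsto> p\<close> too: otherwise a sequence of steps with constant indices starting
  from points tending to \<open>p\<close> has end points converging into \<open>T p =
  {p}\<close>, and those indices pass to the limit. Hence the distance to \<open>p\<close> does
  not increase once the sequence is near \<open>p\<close>.
\<close>

section \<open>Constant subsequences, gradients and first-order bounds\<close>

lemma ex_constant_subseq:
  assumes "finite A" "\<And>n::nat. a n \<in> A"
  obtains c and r :: "nat \<Rightarrow> nat" where "c \<in> A" "strict_mono r" "\<And>n. a (r n) = c"
proof -
  have "finite (range a)"
    using assms by (meson finite_subset image_subsetI)
  then obtain n0 where "infinite {n. a n = a n0}"
    using pigeonhole_infinite[of UNIV a] by auto
  then obtain r :: "nat \<Rightarrow> nat" where "strict_mono r" "\<forall>n. r n \<in> {n. a n = a n0}"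
    using infinite_enumerate by blast
  with assms(2) that show thesis by auto
qed

lemma GDERIV_unique:
  assumes "GDERIV f x :> D" "GDERIV f x :> E"
  shows "D = E"
proof -
  have "(\<lambda>h. h \<bullet> D) = (\<lambda>h. h \<bullet> E)"
    using assms unfolding gderiv_def by (rule has_derivative_unique)
  then have "(D - E) \<bullet> D = (D - E) \<bullet> E"
    by (rule fun_cong)
  then have "(D - E) \<bullet> (D - E) = 0"
    by (simp add: inner_diff_right)
  then show ?thesis by simp
qed

text \<open>\<open>grad\<close> is a definite description, so it carries information only once a
  gradient exists and is unique. Existence comes from the Riesz representative of the derivative,
  written out in the orthonormal basis.\<close>

lemma GDERIV_grad:
  fixes f :: "'a::euclidean_space \<Rightarrow> real"
  assumes "f differentiable_on UNIV"
  shows "GDERIV f x :> grad f x"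
proof -
  obtain D where D: "(f has_derivative D) (at x)"
    using assms by (auto simp: differentiable_on_def differentiable_def)
  then interpret D: bounded_linear D
    by (rule has_derivative_bounded_linear)
  have "D h = h \<bullet> (\<Sum>b\<in>Basis. D b *\<^sub>R b)" for h
  proof -
    have "D h = D (\<Sum>b\<in>Basis. (h \<bullet> b) *\<^sub>R b)"
      by (simp add: euclidean_representation)
    also have "\<dots> = (\<Sum>b\<in>Basis. (h \<bullet> b) * D b)"
      by (simp add: D.sum D.scaleR)
    finally show ?thesis
      by (simp add: inner_sum_right mult.commute)
  qed
  then have *: "GDERIV f x :> (\<Sum>b\<in>Basis. D b *\<^sub>R b)"
    using D unfolding gderiv_def by (metis (no_types, lifting) ext)
  then have "grad f x = (\<Sum>b\<in>Basis. D b *\<^sub>R b)"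
    unfolding grad_def by (blast intro: the_equality GDERIV_unique)
  with * show ?thesis
    by simp
qed

lemma has_real_derivative_along_line:
  assumes "\<And>y. GDERIV f y :> grad f y"
  shows "((\<lambda>t. f (x + t *\<^sub>R d)) has_real_derivative grad f (x + t *\<^sub>R d) \<bullet> d) (at t within S)"
proof -
  have "((\<lambda>t. x + t *\<^sub>R d) has_derivative (\<lambda>s. s *\<^sub>R d)) (at t within S)"
    by (auto intro!: derivative_eq_intros)
  moreover have "(f has_derivative (\<lambda>h. h \<bullet> grad f (x + t *\<^sub>R d))) (at (x + t *\<^sub>R d))"
    using assms unfolding gderiv_def by blast
  ultimately have "((\<lambda>t. f (x + t *\<^sub>R d)) has_derivative
      (\<lambda>s. (s *\<^sub>R d) \<bullet> grad f (x + t *\<^sub>R d))) (at t within S)"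
    by (rule has_derivative_compose)
  then show ?thesis
    unfolding has_field_derivative_def
    by (rule has_derivative_eq_rhs) (auto simp: inner_commute)
qed

text \<open>Along the segment from \<open>x\<close> to \<open>y\<close>, the difference
  \<open>\<phi>\<close> between \<open>f\<close> and its quadratic model has a nonpositive
  derivative for \<open>t\<close> at least 0, by Cauchy-Schwarz and the Lipschitz bound. Comparing
  \<open>\<phi> 1\<close> with \<open>\<phi> 0\<close> gives the claim.\<close>

lemma lipschitz_grad_upper_bound:
  assumes deriv: "\<And>y. GDERIV f y :> grad f y"
    and lip: "L-lipschitz_on UNIV (grad f)"
  shows "f y \<le> f x + grad f x \<bullet> (y - x) + L / 2 * (norm (y - x))\<^sup>2"
proof -
  define d where "d = y - x"
  define \<phi> where "\<phi> t = f (x + t *\<^sub>R d) - t * (grad f x \<bullet> d) - L / 2 * t\<^sup>2 * (norm d)\<^sup>2" for t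
  have "(\<phi> has_real_derivative
      grad f (x + t *\<^sub>R d) \<bullet> d - grad f x \<bullet> d - L * t * (norm d)\<^sup>2) (at t)" for t
    unfolding \<phi>_def
    by (auto intro!: derivative_eq_intros has_real_derivative_along_line deriv)
  moreover have "grad f (x + t *\<^sub>R d) \<bullet> d - grad f x \<bullet> d - L * t * (norm d)\<^sup>2 \<le> 0" if "0 \<le> t" for t
  proof -
    have "(grad f (x + t *\<^sub>R d) - grad f x) \<bullet> d \<le> norm (grad f (x + t *\<^sub>R d) - grad f x) * norm d"
      by (rule norm_cauchy_schwarz)
    also have "\<dots> \<le> (L * norm (t *\<^sub>R d)) * norm d"
      using lipschitz_onD[OF lip, of "x + t *\<^sub>R d" x] by (intro mult_right_mono) (auto simp: dist_norm)
    finally show ?thesis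
      using that by (simp add: inner_diff_left power2_eq_square mult.assoc)
  qed
  ultimately have "\<phi> 1 \<le> \<phi> 0"
    by (intro DERIV_nonpos_imp_nonincreasing[of 0 1 \<phi>] exI conjI) auto
  then show ?thesis
    by (simp add: \<phi>_def d_def)
qed

text \<open>Restriction to the line through \<open>x\<close> and \<open>y\<close> reduces this to
  the tangent inequality for convex functions of one real variable.\<close>

lemma convex_on_grad_lower_bound:
  assumes deriv: "\<And>y. GDERIV h y :> grad h y"
    and conv: "convex_on UNIV h"
  shows "h x + grad h x \<bullet> (y - x) \<le> h y"
proof -
  define \<phi> where "\<phi> t = h (x + t *\<^sub>R (y - x))" for t
  have "convex_on UNIV \<phi>"
  proof (rule convex_onI)
    fix t a b :: real
    assume t: "0 < t" "t < 1"
    have "x + ((1 - t) *\<^sub>R a + t *\<^sub>R b) *\<^sub>R (y - x)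
        = (1 - t) *\<^sub>R (x + a *\<^sub>R (y - x)) + t *\<^sub>R (x + b *\<^sub>R (y - x))"
      by (simp add: algebra_simps)
    then show "\<phi> ((1 - t) *\<^sub>R a + t *\<^sub>R b) \<le> (1 - t) * \<phi> a + t * \<phi> b"
      unfolding \<phi>_def using t by (simp add: convex_onD[OF conv])
  qed auto
  moreover have "(\<phi> has_real_derivative grad h x \<bullet> (y - x)) (at 0 within UNIV)"
    using has_real_derivative_along_line[OF deriv, of x "y - x" 0] by (simp add: \<phi>_def[abs_def])
  ultimately have "(grad h x \<bullet> (y - x)) * (1 - 0) \<le> \<phi> 1 - \<phi> 0"
    by (intro convex_on_imp_above_tangent[of UNIV \<phi> 0 1]) simp_all
  then show ?thesis
    by (simp add: \<phi>_def)
qed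

lemma grad_eq_0_at_max:
  assumes "GDERIV h x :> grad h x" "\<And>y. h y \<le> h x"
  shows "grad h x = 0"
proof -
  have "(\<lambda>d. d \<bullet> grad h x) = (\<lambda>d. 0)"
    using assms(1) assms(2) unfolding gderiv_def
    by (intro has_derivative_local_max[of h _ x]) auto
  then have "grad h x \<bullet> grad h x = 0"
    by (rule fun_cong)
  then show ?thesis by simp
qed

section \<open>Finite minima and maxima\<close>

lemma min_fun_le:
  "finite I \<Longrightarrow> i \<in> I \<Longrightarrow> min_fun I q x \<le> q i x"
  by (simp add: min_fun_def)

lemma le_max_fun:
  "finite M \<Longrightarrow> m \<in> M \<Longrightarrow> q m x \<le> max_fun M q x"
  by (simp add: max_fun_def)

lemma min_fun_active:
  assumes "finite I" "I \<noteq> {}"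
  obtains i where "i \<in> I" "min_fun I q x = q i x"
proof -
  have "min_fun I q x \<in> (\<lambda>i. q i x) ` I"
    unfolding min_fun_def using assms by (intro Min_in) auto
  with that show thesis by blast
qed

lemma max_fun_active:
  assumes "finite M" "M \<noteq> {}"
  obtains m where "m \<in> M" "max_fun M q x = q m x"
proof -
  have "max_fun M q x \<in> (\<lambda>m. q m x) ` M"
    unfolding max_fun_def using assms by (intro Max_in) auto
  with that show thesis by blast
qed

lemma continuous_on_min_fun:
  fixes q :: "'i \<Rightarrow> 'a::topological_space \<Rightarrow> real"
  assumes "finite I" "I \<noteq> {}" "\<And>i. i \<in> I \<Longrightarrow> continuous_on S (q i)"
  shows "continuous_on S (min_fun I q)"
  using assms
proof (induction rule: finite_ne_induct)
  case (singleton i)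
  then show ?case by (simp add: min_fun_def[abs_def])
next
  case (insert i I)
  have "min_fun (insert i I) q = (\<lambda>x. min (q i x) (min_fun I q x))"
    by (intro ext) (simp add: min_fun_def insert.hyps)
  with insert show ?case
    by (simp add: continuous_on_min)
qed

lemma continuous_on_max_fun:
  fixes q :: "'m \<Rightarrow> 'a::topological_space \<Rightarrow> real"
  assumes "finite M" "M \<noteq> {}" "\<And>m. m \<in> M \<Longrightarrow> continuous_on S (q m)"
  shows "continuous_on S (max_fun M q)"
  using assms
proof (induction rule: finite_ne_induct)
  case (singleton m)
  then show ?case by (simp add: max_fun_def[abs_def])
next
  case (insert m M)
  have "max_fun (insert m M) q = (\<lambda>x. max (q m x) (max_fun M q x))"
    by (intro ext) (simp add: max_fun_def insert.hyps)
  with insert show ?case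
    by (simp add: continuous_on_max)
qed

lemma proper_min_fun:
  assumes "finite J" "J \<noteq> {}" "\<And>j. j \<in> J \<Longrightarrow> proper (g j)"
  shows "proper (min_fun J g)"
proof -
  obtain j y where "j \<in> J" "g j y < \<infinity>"
    using assms unfolding proper_def effective_domain_def by blast
  then have "min_fun J g y < \<infinity>"
    using min_fun_le[OF assms(1)] by (metis le_less_trans)
  moreover have "min_fun J g x \<noteq> - \<infinity>" for x
    using min_fun_active[OF assms(1,2)] assms(3) unfolding proper_def by metis
  ultimately show ?thesis
    unfolding proper_def effective_domain_def by blast
qed

section \<open>Proximal maps\<close>

lemma prox_iff:
  "z \<in> prox lam q y \<longleftrightarrow>
     (\<forall>u. q z + ereal (1 / (2 * lam) * (norm (z - y))\<^sup>2) \<le> q u + ereal (1 / (2 * lam) * (norm (u - y))\<^sup>2))"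
  by (auto simp: prox_def is_arg_min_def not_less)

lemma prox_finite:
  assumes "proper q" "z \<in> prox lam q y"
  shows "\<bar>q z\<bar> \<noteq> \<infinity>"
proof -
  obtain u where "q u < \<infinity>"
    using assms(1) unfolding proper_def effective_domain_def by blast
  then have "q u + ereal (1 / (2 * lam) * (norm (u - y))\<^sup>2) < \<infinity>"
    by simp
  with assms(2) have "q z + ereal (1 / (2 * lam) * (norm (z - y))\<^sup>2) < \<infinity>"
    unfolding prox_iff by (metis le_less_trans)
  moreover have "q z \<noteq> -\<infinity>"
    using assms(1) unfolding proper_def by blast
  ultimately show ?thesis by auto
qed

lemma prox_real_le:
  assumes "\<bar>q z\<bar> \<noteq> \<infinity>" "\<bar>q u\<bar> \<noteq> \<infinity>" "z \<in> prox lam q y"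
  shows "real_of_ereal (q z) + 1 / (2 * lam) * (norm (z - y))\<^sup>2
    \<le> real_of_ereal (q u) + 1 / (2 * lam) * (norm (u - y))\<^sup>2"
proof -
  obtain a b where "q z = ereal a" "q u = ereal b"
    using assms(1,2) by (metis ereal_real')
  then show ?thesis
    using assms(3) unfolding prox_iff by (metis ereal_less_eq(3) plus_ereal.simps(1) real_of_ereal.simps(1))
qed

lemma norm_convex_combination_sq:
  fixes x y :: "'a::real_inner"
  shows "(norm ((1 - t) *\<^sub>R x + t *\<^sub>R y))\<^sup>2
    = (1 - t) * (norm x)\<^sup>2 + t * (norm y)\<^sup>2 - t * (1 - t) * (norm (y - x))\<^sup>2"
  unfolding power2_norm_eq_inner
  by (simp add: inner_add_left inner_add_right inner_diff_left inner_diff_right inner_commute algebra_simps)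

text \<open>The function minimized by the prox is convex with modulus
  \<open>\<rho> + 1 / lam\<close>. Comparing its minimizer \<open>z\<close> with a point of the
  segment from \<open>z\<close> to \<open>u\<close>, dividing by \<open>t\<close> and letting
  \<open>t\<close> tend to 0 leaves the full quadratic term.\<close>

lemma prox_quadratic_growth:
  fixes q :: "'a::real_inner \<Rightarrow> ereal"
  assumes "proper q" "rho_convex \<rho> q" "z \<in> prox lam q y" "\<bar>q u\<bar> \<noteq> \<infinity>"
  shows "real_of_ereal (q z) + 1 / (2 * lam) * (norm (z - y))\<^sup>2 + (\<rho> + 1 / lam) / 2 * (norm (u - z))\<^sup>2
    \<le> real_of_ereal (q u) + 1 / (2 * lam) * (norm (u - y))\<^sup>2"
proof -
  define c where "c = 1 / (2 * lam)"
  define N where "N = (norm (u - z))\<^sup>2"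
  define s where "s = \<rho> / 2"
  obtain a where a: "q z = ereal a"
    using prox_finite[OF assms(1,3)] by (metis ereal_real')
  obtain b where b: "q u = ereal b"
    using assms(4) by (metis ereal_real')
  \<comment> \<open>The factor \<open>1 - t\<close> is what the curvature term
    \<open>t * (1 - t)\<close> leaves after division by \<open>t\<close>; \<open>s + c\<close> is
    half the modulus.\<close>
  have *: "a + c * (norm (z - y))\<^sup>2 + (1 - t) * ((s + c) * N) \<le> b + c * (norm (u - y))\<^sup>2"
    if t: "0 < t" "t \<le> 1" for t
  proof -
    define x where "x = (1 - t) *\<^sub>R z + t *\<^sub>R u"
    have "q x - ereal (\<rho> / 2 * (norm x)\<^sup>2) \<le>
        ereal (1 - t) * (q z - ereal (\<rho> / 2 * (norm z)\<^sup>2)) + ereal t * (q u - ereal (\<rho> / 2 * (norm u)\<^sup>2))"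
      using assms(2) t unfolding rho_convex_def ereal_convex_def x_def by auto
    then have qx: "q x - ereal (\<rho> / 2 * (norm x)\<^sup>2) \<le>
        ereal ((1 - t) * (a - \<rho> / 2 * (norm z)\<^sup>2) + t * (b - \<rho> / 2 * (norm u)\<^sup>2))"
      by (simp add: a b)
    have "q x \<noteq> -\<infinity>"
      using assms(1) unfolding proper_def by blast
    \<comment> \<open>Convexity bounds \<open>q x\<close> by a finite number, because
      \<open>q\<close> is finite at both \<open>z\<close> and \<open>u\<close>.\<close>
    with qx obtain e where e: "q x = ereal e"
      by (cases "q x") auto
    have 1: "e - \<rho> / 2 * (norm x)\<^sup>2 \<le> (1 - t) * (a - \<rho> / 2 * (norm z)\<^sup>2) + t * (b - \<rho> / 2 * (norm u)\<^sup>2)"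
      using qx by (simp add: e)
    have 2: "a + c * (norm (z - y))\<^sup>2 \<le> e + c * (norm (x - y))\<^sup>2"
      using prox_real_le[of q z x lam y] assms(3) by (simp add: a e c_def)
    have 3: "(norm x)\<^sup>2 = (1 - t) * (norm z)\<^sup>2 + t * (norm u)\<^sup>2 - t * (1 - t) * N"
      unfolding x_def N_def by (rule norm_convex_combination_sq)
    have "x - y = (1 - t) *\<^sub>R (z - y) + t *\<^sub>R (u - y)"
      by (simp add: x_def algebra_simps)
    then have 4: "(norm (x - y))\<^sup>2 = (1 - t) * (norm (z - y))\<^sup>2 + t * (norm (u - y))\<^sup>2 - t * (1 - t) * N"
      using norm_convex_combination_sq[of t "z - y" "u - y"] by (simp add: N_def)
    have "e - s * (norm x)\<^sup>2 \<le> (1 - t) * (a - s * (norm z)\<^sup>2) + t * (b - s * (norm u)\<^sup>2)"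
      using 1 by (simp only: s_def)
    with 2 have "t * (a + c * (norm (z - y))\<^sup>2 + (1 - t) * ((s + c) * N)) \<le> t * (b + c * (norm (u - y))\<^sup>2)"
      unfolding 3 4 by (simp add: algebra_simps)
    then show ?thesis
      using t by simp
  qed
  have "((\<lambda>t. a + c * (norm (z - y))\<^sup>2 + (1 - t) * ((s + c) * N)) \<longlongrightarrow>
      a + c * (norm (z - y))\<^sup>2 + (1 - 0) * ((s + c) * N)) (at_right 0)"
    by (intro tendsto_intros)
  moreover have "eventually (\<lambda>t. a + c * (norm (z - y))\<^sup>2 + (1 - t) * ((s + c) * N)
      \<le> b + c * (norm (u - y))\<^sup>2) (at_right 0)"
    using eventually_at_right_real[OF zero_less_one] by (rule eventually_mono) (simp add: *)
  ultimately have "a + c * (norm (z - y))\<^sup>2 + (1 - 0) * ((s + c) * N) \<le> b + c * (norm (u - y))\<^sup>2"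
    by (rule tendsto_upperbound) simp
  then show ?thesis
    by (simp add: a b c_def s_def N_def algebra_simps add_divide_distrib)
qed

text \<open>Each minimizer is tested in the growth inequality of the other. In the sum the values of
  \<open>q\<close> cancel and the squared norms collapse to the inner product of
  \<open>z1 - z2\<close> and \<open>y1 - y2\<close>; Cauchy-Schwarz finishes.\<close>

lemma prox_contraction:
  fixes q :: "'a::real_inner \<Rightarrow> ereal"
  assumes "proper q" "rho_convex \<rho> q" "0 < lam" "z1 \<in> prox lam q y1" "z2 \<in> prox lam q y2"
  shows "(1 + lam * \<rho>) * norm (z1 - z2) \<le> norm (y1 - y2)"
proof -
  define c where "c = 1 / (2 * lam)"
  define \<sigma> where "\<sigma> = \<rho> + 1 / lam"
  have fin: "\<bar>q z1\<bar> \<noteq> \<infinity>" "\<bar>q z2\<bar> \<noteq> \<infinity>"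
    using prox_finite[OF assms(1,4)] prox_finite[OF assms(1,5)] by simp_all
  have "\<sigma> * (norm (z1 - z2))\<^sup>2
      \<le> c * ((norm (z2 - y1))\<^sup>2 - (norm (z1 - y1))\<^sup>2 + (norm (z1 - y2))\<^sup>2 - (norm (z2 - y2))\<^sup>2)"
    using prox_quadratic_growth[OF assms(1,2,4) fin(2)] prox_quadratic_growth[OF assms(1,2,5) fin(1)]
    unfolding c_def[symmetric] \<sigma>_def[symmetric] norm_minus_commute[of z2 z1] by (simp add: algebra_simps)
  also have "(norm (z2 - y1))\<^sup>2 - (norm (z1 - y1))\<^sup>2 + (norm (z1 - y2))\<^sup>2 - (norm (z2 - y2))\<^sup>2
      = 2 * ((z1 - z2) \<bullet> (y1 - y2))"
    unfolding power2_norm_eq_inner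
    by (simp add: inner_diff_left inner_diff_right inner_commute algebra_simps)
  finally have "lam * (\<sigma> * (norm (z1 - z2))\<^sup>2) \<le> lam * (c * (2 * ((z1 - z2) \<bullet> (y1 - y2))))"
    using assms(3) by (simp add: mult_left_mono)
  moreover have "1 + lam * \<rho> = lam * \<sigma>" "lam * c * 2 = 1"
    using assms(3) by (simp_all add: c_def \<sigma>_def distrib_left)
  ultimately have "(1 + lam * \<rho>) * (norm (z1 - z2))\<^sup>2 \<le> (z1 - z2) \<bullet> (y1 - y2)"
    by (simp add: mult.assoc[symmetric])
  also have "\<dots> \<le> norm (z1 - z2) * norm (y1 - y2)"
    by (rule norm_cauchy_schwarz)
  finally have "norm (z1 - z2) * ((1 + lam * \<rho>) * norm (z1 - z2)) \<le> norm (z1 - z2) * norm (y1 - y2)"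
    by (simp add: power2_eq_square algebra_simps)
  then show ?thesis
    by (cases "z1 = z2") (auto simp: mult_le_cancel_left_pos)
qed

text \<open>\<open>q\<close> lies above \<open>F\<close> and touches it at the minimizer. Applied to
  a minimum of pieces and its active piece, this replaces the prox of the minimum by the prox of one
  \<open>\<rho>\<close>-convex function, where \<open>prox_contraction\<close> is available.\<close>

lemma prox_mono:
  assumes "\<And>u. F u \<le> q u" "F z = q z" "z \<in> prox lam F y"
  shows "z \<in> prox lam q y"
  using assms unfolding prox_iff by (metis add_right_mono order_trans)

text \<open>Closedness keeps the limit inside the domain, and only there is continuity
  assumed.\<close>

lemma closed_domain_limit:
  assumes "proper q" "closed (effective_domain q)" "continuous_on (effective_domain q) q"
    and "z \<longlonglongrightarrow> p" "\<And>n. q (z n) < \<infinity>"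
  shows "\<bar>q p\<bar> \<noteq> \<infinity>" "(\<lambda>n. q (z n)) \<longlonglongrightarrow> q p"
proof -
  have z: "z n \<in> effective_domain q" for n
    using assms(5) by (simp add: effective_domain_def)
  then have p: "p \<in> effective_domain q"
    using closed_sequentially[OF assms(2)] assms(4) by blast
  with assms(1) show "\<bar>q p\<bar> \<noteq> \<infinity>"
    unfolding proper_def effective_domain_def by auto
  show "(\<lambda>n. q (z n)) \<longlonglongrightarrow> q p"
    using continuous_on_tendsto_compose[OF assms(3,4) p] z by simp
qed

text \<open>The graph of the prox is closed along sequences on which one piece \<open>q\<close>
  stays active. Minimality is an inequality against each fixed \<open>u\<close>, so it survives the
  limit.\<close>

lemma prox_limit:
  assumes F: "proper F" and q: "proper q" "closed (effective_domain q)" "continuous_on (effective_domain q) q"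
    and le: "\<And>u. F u \<le> q u" and eq: "\<And>n. F (z n) = q (z n)"
    and prox: "\<And>n. z n \<in> prox lam F (y n)"
    and lim: "y \<longlonglongrightarrow> y'" "z \<longlonglongrightarrow> z'"
  shows "F z' = q z'" "z' \<in> prox lam F y'"
proof -
  have "q (z n) < \<infinity>" for n
    using prox_finite[OF F prox, of n] by (cases "q (z n)") (simp_all add: eq)
  note limq = closed_domain_limit[OF q lim(2) this]
  \<comment> \<open>The left side carries \<open>q\<close> and not \<open>F\<close>, since
    continuity is at hand for \<open>q\<close> only.\<close>
  have *: "q z' + ereal (1 / (2 * lam) * (norm (z' - y'))\<^sup>2)
      \<le> F u + ereal (1 / (2 * lam) * (norm (u - y'))\<^sup>2)" for u
  proof (cases "F u = \<infinity>")
    case False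
    then have "\<bar>F u\<bar> \<noteq> \<infinity>"
      using F unfolding proper_def by auto
    then show ?thesis
      using prox eq unfolding prox_iff
      by (intro LIMSEQ_le[of "\<lambda>n. q (z n) + ereal (1 / (2 * lam) * (norm (z n - y n))\<^sup>2)" _
            "\<lambda>n. F u + ereal (1 / (2 * lam) * (norm (u - y n))\<^sup>2)"]
            tendsto_add_ereal limq tendsto_ereal tendsto_intros lim exI) auto
  qed simp
  \<comment> \<open>Testing at \<open>u = z'\<close> shows that \<open>q\<close> is still active in
    the limit.\<close>
  from *[of z'] have "q z' \<le> F z'"
    using limq(1) by (cases "F z'"; cases "q z'") auto
  with le show "F z' = q z'"
    by (simp add: antisym)
  with * show "z' \<in> prox lam F y'"
    unfolding prox_iff by simp
qed

section \<open>The set-valued operator and descent along a step\<close>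

lemma T_PDMC_E:
  assumes "z \<in> T_PDMC lam I f J g M h x"
  obtains i m where "i \<in> I" "min_fun I f x = f i x" "m \<in> M" "max_fun M h x = h m x"
    "z \<in> prox lam (min_fun J g) (x - lam *\<^sub>R grad (f i) x + lam *\<^sub>R grad (h m) x)"
  using assms unfolding T_PDMC_def active_grads_def active_set_def by auto

lemma T_PDMC_I:
  assumes "i \<in> I" "min_fun I f x = f i x" "m \<in> M" "max_fun M h x = h m x"
    "z \<in> prox lam (min_fun J g) (x - lam *\<^sub>R grad (f i) x + lam *\<^sub>R grad (h m) x)"
  shows "z \<in> T_PDMC lam I f J g M h x"
  using assms unfolding T_PDMC_def active_grads_def active_set_def by blast

text \<open>Minimality of \<open>z\<close> is compared with the candidate \<open>x\<close>. The
  minimum lies below its piece active at \<open>x\<close>, hence below that quadratic model, and the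
  maximum lies above its piece active at \<open>x\<close>, hence above that tangent; both estimates
  have the direction needed.\<close>

lemma T_PDMC_descent:
  fixes f :: "'i \<Rightarrow> 'a::real_inner \<Rightarrow> real"
  assumes fin: "finite I" "finite M" and lam: "0 < lam"
    and f: "\<And>i x y. i \<in> I \<Longrightarrow> f i y \<le> f i x + grad (f i) x \<bullet> (y - x) + K / 2 * (norm (y - x))\<^sup>2"
    and h: "\<And>m x y. m \<in> M \<Longrightarrow> h m x + grad (h m) x \<bullet> (y - x) \<le> h m y"
    and g: "proper (min_fun J g)" "\<bar>min_fun J g x\<bar> \<noteq> \<infinity>"
    and z: "z \<in> T_PDMC lam I f J g M h x"
  shows "min_fun I f z + real_of_ereal (min_fun J g z) - max_fun M h z
      + (1 / (2 * lam) - K / 2) * (norm (z - x))\<^sup>2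
    \<le> min_fun I f x + real_of_ereal (min_fun J g x) - max_fun M h x"
proof -
  from z obtain i m where i: "i \<in> I" "min_fun I f x = f i x" and m: "m \<in> M" "max_fun M h x = h m x"
    and p: "z \<in> prox lam (min_fun J g) (x - lam *\<^sub>R grad (f i) x + lam *\<^sub>R grad (h m) x)"
    by (rule T_PDMC_E)
  define d where "d = grad (f i) x - grad (h m) x"
  have y: "x - lam *\<^sub>R grad (f i) x + lam *\<^sub>R grad (h m) x = x - lam *\<^sub>R d"
    by (simp add: d_def algebra_simps)
  have "real_of_ereal (min_fun J g z) + 1 / (2 * lam) * (norm (z - (x - lam *\<^sub>R d)))\<^sup>2
      \<le> real_of_ereal (min_fun J g x) + 1 / (2 * lam) * (norm (x - (x - lam *\<^sub>R d)))\<^sup>2"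
    using p unfolding y by (intro prox_real_le prox_finite[OF g(1)] g)
  \<comment> \<open>The last summand is also the squared distance from \<open>x\<close> to the prox
    argument, so it cancels; the cross term divided by \<open>2 * lam\<close> is the linear part of
    the two models.\<close>
  moreover have "(norm (z - (x - lam *\<^sub>R d)))\<^sup>2 = (norm (z - x))\<^sup>2 + 2 * lam * (d \<bullet> (z - x)) + (norm (lam *\<^sub>R d))\<^sup>2"
    unfolding power2_norm_eq_inner
    by (simp add: inner_add_left inner_add_right inner_diff_left inner_diff_right inner_commute algebra_simps)
  ultimately have "real_of_ereal (min_fun J g z) + 1 / (2 * lam) * (norm (z - x))\<^sup>2 + d \<bullet> (z - x)
      \<le> real_of_ereal (min_fun J g x)"
    using lam by (simp add: distrib_left)
  moreover have "min_fun I f z \<le> f i x + grad (f i) x \<bullet> (z - x) + K / 2 * (norm (z - x))\<^sup>2"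
    using min_fun_le[OF fin(1) i(1), of f z] f[OF i(1)] by (meson order_trans)
  moreover have "h m x + grad (h m) x \<bullet> (z - x) \<le> max_fun M h z"
    using le_max_fun[OF fin(2) m(1), of h z] h[OF m(1)] by (meson order_trans)
  ultimately show ?thesis
    unfolding i(2) m(2) d_def by (simp add: inner_diff_left left_diff_distrib)
qed

section \<open>Bounded sublevel sets and accumulation points\<close>

lemma sublevel_bounded_if_coercive:
  assumes "coercive q"
  shows "bounded {x. q x \<le> ereal C}"
proof -
  have "eventually (\<lambda>x. ereal C < q x) at_infinity"
    using assms unfolding coercive_def tendsto_PInfty by blast
  then obtain b where "\<And>x. b \<le> norm x \<Longrightarrow> ereal C < q x"
    unfolding eventually_at_infinity by blast
  then have "norm x \<le> b" if "q x \<le> ereal C" for x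
    using that by (meson linorder_not_less nle_le)
  then show ?thesis
    unfolding bounded_iff by blast
qed

text \<open>Some iterate enters any given ball about \<open>p\<close>, and a step inside radius
  \<open>\<delta>\<close> does not increase the distance, so the sequence never leaves that ball
  again.\<close>

lemma accumulation_point_local_contraction:
  fixes w :: "nat \<Rightarrow> 'a::real_normed_vector"
  assumes acc: "accumulation_point w p" and "0 < \<delta>" "0 \<le> \<kappa>" "\<kappa> \<le> 1"
    and step: "\<And>k. norm (w k - p) < \<delta> \<Longrightarrow> norm (w (Suc k) - p) \<le> \<kappa> * norm (w k - p)"
  shows "w \<longlonglongrightarrow> p" "\<forall>\<^sub>F k in sequentially. norm (w (Suc k) - p) \<le> \<kappa> * norm (w k - p)"
proof -
  \<comment> \<open>Trapping in every ball of radius at most \<open>\<delta>\<close> yields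
    convergence even for \<open>\<kappa> = 1\<close>; the radius \<open>\<delta>\<close> itself
    makes the step estimate hold eventually.\<close>
  have stay: "\<exists>k0. \<forall>k\<ge>k0. norm (w k - p) < e" if e: "0 < e" "e \<le> \<delta>" for e
  proof -
    obtain r where "(w \<circ> r) \<longlonglongrightarrow> p"
      using acc unfolding accumulation_point_def by blast
    then obtain n where n: "norm (w (r n) - p) < e"
      using LIMSEQ_D[of "w \<circ> r" p e] e by auto
    have "norm (w k - p) < e" if "r n \<le> k" for k
      using that
    proof (induction k rule: dec_induct)
      case base
      show ?case by (rule n)
    next
      case (step k)
      then have "norm (w (Suc k) - p) \<le> \<kappa> * norm (w k - p)"
        using assms(5) e by simp
      also have "\<dots> \<le> 1 * norm (w k - p)"
        using assms(4) by (rule mult_right_mono) simp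
      finally show ?case using step by simp
    qed
    then show ?thesis by blast
  qed
  show "w \<longlonglongrightarrow> p"
  proof (rule LIMSEQ_I)
    fix e :: real
    assume "0 < e"
    then show "\<exists>k0. \<forall>k\<ge>k0. norm (w k - p) < e"
      using stay[of "min e \<delta>"] assms(2) by auto
  qed
  show "\<forall>\<^sub>F k in sequentially. norm (w (Suc k) - p) \<le> \<kappa> * norm (w k - p)"
    using stay[of \<delta>] assms(2) step unfolding eventually_sequentially by blast
qed

section \<open>The standing assumptions and steps with fixed indices\<close>

locale pdmc =
  fixes I :: "'i set" and J :: "'j set" and M :: "'m set"
    and f :: "'i \<Rightarrow> 'a::euclidean_space \<Rightarrow> real"
    and g :: "'j \<Rightarrow> 'a \<Rightarrow> ereal"
    and h :: "'m \<Rightarrow> 'a \<Rightarrow> real"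
    and L :: "'i \<Rightarrow> real"
    and \<rho> lam :: real
  assumes I: "finite I" "I \<noteq> {}" and J: "finite J" "J \<noteq> {}" and M: "finite M" "M \<noteq> {}"
    and L_pos: "\<And>i. i \<in> I \<Longrightarrow> L i > 0"
    and f_diff: "\<And>i. i \<in> I \<Longrightarrow> f i differentiable_on UNIV"
    and f_lip: "\<And>i. i \<in> I \<Longrightarrow> (L i)-lipschitz_on UNIV (grad (f i))"
    and g_proper: "\<And>j. j \<in> J \<Longrightarrow> proper (g j)"
    and g_conv: "\<And>j. j \<in> J \<Longrightarrow> rho_convex \<rho> (g j)"
    and g_closed: "\<And>j. j \<in> J \<Longrightarrow> closed (effective_domain (g j))"
    and g_cont: "\<And>j. j \<in> J \<Longrightarrow> continuous_on (effective_domain (g j)) (g j)"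
    and h_diff: "\<And>m. m \<in> M \<Longrightarrow> h m differentiable_on UNIV"
    and h_cont: "\<And>m. m \<in> M \<Longrightarrow> continuous_on UNIV (grad (h m))"
    and h_conv: "\<And>m. m \<in> M \<Longrightarrow> convex_on UNIV (h m)"
    and coercive: "\<And>i j m. i \<in> I \<Longrightarrow> j \<in> J \<Longrightarrow> m \<in> M \<Longrightarrow>
           coercive (\<lambda>x. ereal (f i x) + g j x - ereal (h m x))"
    and lam: "0 < lam" "lam < 1 / (MAX i\<in>I. L i)"
begin

abbreviation "F \<equiv> min_fun I f"
abbreviation "G \<equiv> min_fun J g"
abbreviation "H \<equiv> max_fun M h"
abbreviation "T \<equiv> T_PDMC lam I f J g M h"

definition shift :: "'i \<Rightarrow> 'm \<Rightarrow> 'a \<Rightarrow> 'a" where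
  "shift i m x = x - lam *\<^sub>R grad (f i) x + lam *\<^sub>R grad (h m) x"

text \<open>\<open>T\<close> itself does not mention \<open>j\<close>. It is recorded at the end
  point \<open>z\<close> because \<open>z\<close> is then also a prox point of the single piece
  \<open>g j\<close>.\<close>

definition step_via :: "'i \<Rightarrow> 'j \<Rightarrow> 'm \<Rightarrow> 'a \<Rightarrow> 'a \<Rightarrow> bool" where
  "step_via i j m x z \<longleftrightarrow> i \<in> I \<and> j \<in> J \<and> m \<in> M \<and>
     F x = f i x \<and> H x = h m x \<and> G z = g j z \<and> z \<in> prox lam G (shift i m x)"

text \<open>\<open>real_of_ereal\<close> sends infinite values to 0, so \<open>obj\<close> is used
  together with finiteness of \<open>G\<close>.\<close>

definition obj :: "'a \<Rightarrow> real" where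
  "obj x = F x + real_of_ereal (G x) - H x"

lemma G_proper: "proper G"
  using proper_min_fun[OF J g_proper] .

lemma T_iff_step_via: "z \<in> T x \<longleftrightarrow> (\<exists>i j m. step_via i j m x z)"
proof
  assume "z \<in> T x"
  then obtain i m where "i \<in> I" "F x = f i x" "m \<in> M" "H x = h m x"
    "z \<in> prox lam G (x - lam *\<^sub>R grad (f i) x + lam *\<^sub>R grad (h m) x)"
    by (rule T_PDMC_E)
  moreover obtain j where "j \<in> J" "G z = g j z"
    using min_fun_active[OF J] .
  ultimately show "\<exists>i j m. step_via i j m x z"
    unfolding step_via_def shift_def by blast
next
  assume "\<exists>i j m. step_via i j m x z"
  then obtain i j m where "step_via i j m x z"
    by blast
  then show "z \<in> T x"
    unfolding step_via_def shift_def by (auto intro: T_PDMC_I)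
qed

lemma step_via_subseq:
  assumes "\<And>n. z n \<in> T (x n)"
  obtains i j m and r :: "nat \<Rightarrow> nat" where "strict_mono r"
    "\<And>n. step_via i j m (x (r n)) (z (r n))"
proof -
  \<comment> \<open>The three indices are coded as one triple, so that a single pigeonhole argument
    makes all of them constant.\<close>
  have "\<forall>n. \<exists>a. step_via (fst a) (fst (snd a)) (snd (snd a)) (x n) (z n)"
    using assms by (simp add: T_iff_step_via)
  then obtain a where a: "\<And>n. step_via (fst (a n)) (fst (snd (a n))) (snd (snd (a n))) (x n) (z n)"
    by metis
  have fin: "finite (I \<times> J \<times> M)"
    using I(1) J(1) M(1) by simp
  have mem: "a n \<in> I \<times> J \<times> M" for n
    using a[of n] by (cases "a n") (auto simp: step_via_def)
  obtain c and r :: "nat \<Rightarrow> nat" where r: "strict_mono r" "\<And>n. a (r n) = c"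
    using ex_constant_subseq[of "I \<times> J \<times> M" a, OF fin mem] by metis
  have "step_via (fst c) (fst (snd c)) (snd (snd c)) (x (r n)) (z (r n))" for n
    using a[of "r n"] r(2) by simp
  with r(1) show thesis
    by (rule that)
qed

lemma f_cont: "i \<in> I \<Longrightarrow> continuous_on UNIV (f i)"
  using f_diff by (rule differentiable_imp_continuous_on)

lemma h_continuous: "m \<in> M \<Longrightarrow> continuous_on UNIV (h m)"
  using h_diff by (rule differentiable_imp_continuous_on)

lemma F_tendsto: "x \<longlonglongrightarrow> p \<Longrightarrow> (\<lambda>n. F (x n)) \<longlonglongrightarrow> F p"
  using continuous_on_tendsto_compose[OF continuous_on_min_fun[OF I, of UNIV f]] f_cont by simp

lemma H_tendsto: "x \<longlonglongrightarrow> p \<Longrightarrow> (\<lambda>n. H (x n)) \<longlonglongrightarrow> H p"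
  using continuous_on_tendsto_compose[OF continuous_on_max_fun[OF M, of UNIV h]] h_continuous by simp

lemma shift_tendsto:
  assumes "i \<in> I" "m \<in> M" "x \<longlonglongrightarrow> p"
  shows "(\<lambda>n. shift i m (x n)) \<longlonglongrightarrow> shift i m p"
proof -
  have "continuous_on UNIV (shift i m)"
    unfolding shift_def[abs_def]
    using lipschitz_on_continuous_on[OF f_lip] h_cont assms by (intro continuous_intros) auto
  then show ?thesis
    using assms(3) by (auto intro: continuous_on_tendsto_compose)
qed

text \<open>For fixed indices the relation is closed: activity of \<open>i\<close> and
  \<open>m\<close> passes to the limit by continuity, activity of \<open>j\<close> and minimality by
  \<open>prox_limit\<close>.\<close>

lemma step_via_limit:
  assumes step: "\<And>n. step_via i j m (x n) (z n)" and lim: "x \<longlonglongrightarrow> p" "z \<longlonglongrightarrow> q"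
  shows "step_via i j m p q"
proof -
  have ijm: "i \<in> I" "j \<in> J" "m \<in> M"
    using step unfolding step_via_def by blast+
  have "G (z n) = g j (z n)" "z n \<in> prox lam G (shift i m (x n))" for n
    using step unfolding step_via_def by blast+
  note Gq = prox_limit[OF G_proper g_proper[OF ijm(2)] g_closed[OF ijm(2)] g_cont[OF ijm(2)]
      min_fun_le[OF J(1) ijm(2)] this shift_tendsto[OF ijm(1,3) lim(1)] lim(2)]
  have "(\<lambda>n. f i (x n)) \<longlonglongrightarrow> F p"
    using F_tendsto[OF lim(1)] step unfolding step_via_def by simp
  moreover have "(\<lambda>n. f i (x n)) \<longlonglongrightarrow> f i p"
    using continuous_on_tendsto_compose[OF f_cont[OF ijm(1)] lim(1)] by simp
  ultimately have "F p = f i p"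
    by (rule LIMSEQ_unique)
  have "(\<lambda>n. h m (x n)) \<longlonglongrightarrow> H p"
    using H_tendsto[OF lim(1)] step unfolding step_via_def by simp
  moreover have "(\<lambda>n. h m (x n)) \<longlonglongrightarrow> h m p"
    using continuous_on_tendsto_compose[OF h_continuous[OF ijm(3)] lim(1)] by simp
  ultimately have "H p = h m p"
    by (rule LIMSEQ_unique)
  with \<open>F p = f i p\<close> Gq ijm show ?thesis
    unfolding step_via_def by blast
qed

section \<open>Descent of the objective and a fixed accumulation point\<close>

lemma T_finite:
  assumes "z \<in> T x"
  shows "\<bar>G z\<bar> \<noteq> \<infinity>"
proof -
  obtain i m where "z \<in> prox lam G (shift i m x)"
    using assms unfolding T_iff_step_via step_via_def by blast
  then show ?thesis
    by (rule prox_finite[OF G_proper])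
qed

text \<open>The constant is \<open>1 / (2 * lam) - K / 2\<close> with \<open>K\<close> the largest
  \<open>L i\<close>; it is positive because \<open>lam < 1 / K\<close>.\<close>

lemma obj_descent:
  "\<exists>c>0. \<forall>x z. \<bar>G x\<bar> \<noteq> \<infinity> \<longrightarrow> z \<in> T x \<longrightarrow> obj z + c * (norm (z - x))\<^sup>2 \<le> obj x"
proof -
  define K where "K = (MAX i\<in>I. L i)"
  have L_le: "L i \<le> K" if "i \<in> I" for i
    using I(1) that by (simp add: K_def)
  have "0 < K"
    using L_le L_pos I(2) by (meson all_not_in_conv less_le_trans)
  then have "K < 1 / lam"
    using lam by (simp add: K_def[symmetric] field_simps)
  then have c: "0 < 1 / (2 * lam) - K / 2"
    by simp
  have f: "f i y \<le> f i x + grad (f i) x \<bullet> (y - x) + K / 2 * (norm (y - x))\<^sup>2" if i: "i \<in> I" for i x y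
  proof -
    have "L i / 2 * (norm (y - x))\<^sup>2 \<le> K / 2 * (norm (y - x))\<^sup>2"
      using L_le[OF i] by (intro mult_right_mono) auto
    then show ?thesis
      using lipschitz_grad_upper_bound[OF GDERIV_grad[OF f_diff[OF i]] f_lip[OF i], of y x] by linarith
  qed
  have h: "h m x + grad (h m) x \<bullet> (y - x) \<le> h m y" if m: "m \<in> M" for m x y
    using convex_on_grad_lower_bound[OF GDERIV_grad[OF h_diff[OF m]] h_conv[OF m]] .
  have "obj z + (1 / (2 * lam) - K / 2) * (norm (z - x))\<^sup>2 \<le> obj x"
    if "\<bar>G x\<bar> \<noteq> \<infinity>" "z \<in> T x" for x z
    unfolding obj_def using T_PDMC_descent[OF I(1) M(1) lam(1) f h G_proper that] .
  with c show ?thesis by blast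
qed

text \<open>Coercivity is assumed for each triple of pieces. A point of the sublevel set lies in the
  sublevel set of any triple active there, and there are finitely many triples.\<close>

lemma bounded_obj_sublevel: "bounded {x. \<bar>G x\<bar> \<noteq> \<infinity> \<and> obj x \<le> C}"
proof (rule bounded_subset)
  show "bounded (\<Union>(i, j, m)\<in>I \<times> J \<times> M. {x. ereal (f i x) + g j x - ereal (h m x) \<le> ereal C})"
    using I(1) J(1) M(1) sublevel_bounded_if_coercive[OF coercive]
    by (intro bounded_UN) auto
  show "{x. \<bar>G x\<bar> \<noteq> \<infinity> \<and> obj x \<le> C} \<subseteq>
      (\<Union>(i, j, m)\<in>I \<times> J \<times> M. {x. ereal (f i x) + g j x - ereal (h m x) \<le> ereal C})"
  proof (rule subsetI)
    fix x
    assume "x \<in> {x. \<bar>G x\<bar> \<noteq> \<infinity> \<and> obj x \<le> C}"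
    then have x: "\<bar>G x\<bar> \<noteq> \<infinity>" "obj x \<le> C"
      by simp_all
    obtain i where i: "i \<in> I" "F x = f i x"
      using min_fun_active[OF I] .
    obtain j where j: "j \<in> J" "G x = g j x"
      using min_fun_active[OF J] .
    obtain m where m: "m \<in> M" "H x = h m x"
      using max_fun_active[OF M] .
    have "ereal (f i x) + g j x - ereal (h m x) \<le> ereal C"
      using x unfolding obj_def i(2) j(2) m(2) by (cases "g j x") auto
    with i j m show "x \<in> (\<Union>(i, j, m)\<in>I \<times> J \<times> M. {x. ereal (f i x) + g j x - ereal (h m x) \<le> ereal C})"
      by blast
  qed
qed

lemma ex_fixed_accumulation_point:
  assumes w: "\<And>k. w (Suc k) \<in> T (w k)"
  shows "\<exists>p. p \<in> Fix T \<and> accumulation_point w p"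
proof -
  obtain c where c: "0 < c"
    and descent: "\<And>x z. \<bar>G x\<bar> \<noteq> \<infinity> \<Longrightarrow> z \<in> T x \<Longrightarrow> obj z + c * (norm (z - x))\<^sup>2 \<le> obj x"
    using obj_descent by blast
  \<comment> \<open>The objective may be infinite at \<open>w 0\<close>.\<close>
  define v where "v k = w (Suc k)" for k
  have v: "v (Suc k) \<in> T (v k)" for k
    unfolding v_def by (rule w)
  have v_fin: "\<bar>G (v k)\<bar> \<noteq> \<infinity>" for k
    unfolding v_def by (rule T_finite[OF w])
  have descent_v: "c * (norm (v (Suc k) - v k))\<^sup>2 \<le> obj (v k) - obj (v (Suc k))" for k
    using descent[OF v_fin v, of k] by linarith
  have "decseq (\<lambda>k. obj (v k))"
  proof (rule decseq_SucI)
    fix k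
    have "0 \<le> c * (norm (v (Suc k) - v k))\<^sup>2"
      using c by simp
    then show "obj (v (Suc k)) \<le> obj (v k)"
      using descent_v[of k] by linarith
  qed
  note dec = decseqD[OF this]
  have bounded_v: "bounded (range (\<lambda>k. v (s k)))" for s :: "nat \<Rightarrow> nat"
  proof (rule bounded_subset[OF bounded_obj_sublevel])
    have "v k \<in> {x. \<bar>G x\<bar> \<noteq> \<infinity> \<and> obj x \<le> obj (v 0)}" for k
      using v_fin[of k] dec[OF le0, of k] by simp
    then show "range (\<lambda>k. v (s k)) \<subseteq> {x. \<bar>G x\<bar> \<noteq> \<infinity> \<and> obj x \<le> obj (v 0)}"
      by (rule image_subsetI)
  qed
  obtain i j m and r1 :: "nat \<Rightarrow> nat" where r1: "strict_mono r1"
    and via: "\<And>n. step_via i j m (v (r1 n)) (v (Suc (r1 n)))"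
    using step_via_subseq[of "\<lambda>k. v (Suc k)" v, OF v] by metis
  obtain p and r2 :: "nat \<Rightarrow> nat" where r2: "strict_mono r2" "((\<lambda>n. v (r1 n)) \<circ> r2) \<longlonglongrightarrow> p"
    using bounded_imp_convergent_subsequence[OF bounded_v] by blast
  \<comment> \<open>Start points and end points get separate limits; these are identified only after
    the step lengths are shown to vanish.\<close>
  obtain p' and r3 :: "nat \<Rightarrow> nat"
    where r3: "strict_mono r3" "((\<lambda>n. v (Suc (r1 (r2 n)))) \<circ> r3) \<longlonglongrightarrow> p'"
    using bounded_imp_convergent_subsequence[OF bounded_v[of "\<lambda>n. Suc (r1 (r2 n))"]] by blast
  define s where "s = r1 \<circ> r2 \<circ> r3"
  have s: "strict_mono s"
    unfolding s_def by (intro strict_mono_o r1 r2(1) r3(1))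
  have lim: "(\<lambda>n. v (s n)) \<longlonglongrightarrow> p"
    using LIMSEQ_subseq_LIMSEQ[OF r2(2) r3(1)] by (simp add: s_def comp_def)
  have lim': "(\<lambda>n. v (Suc (s n))) \<longlonglongrightarrow> p'"
    using r3(2) by (simp add: s_def comp_def)
  have via_s: "step_via i j m (v (s n)) (v (Suc (s n)))" for n
    using via by (simp add: s_def)
  have j: "j \<in> J" and Gj: "\<And>n. G (v (Suc (s n))) = g j (v (Suc (s n)))"
    using via_s unfolding step_via_def by blast+
  have "g j (v (Suc (s n))) < \<infinity>" for n
    using v_fin[of "Suc (s n)"] unfolding Gj by (cases "g j (v (Suc (s n)))") simp_all
  note limg = closed_domain_limit[OF g_proper[OF j] g_closed[OF j] g_cont[OF j] lim' this]
  have "(\<lambda>n. g j (v (Suc (s n)))) \<longlonglongrightarrow> ereal (real_of_ereal (g j p'))"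
    using limg(2) by (simp only: ereal_real'[OF limg(1)])
  then have "(\<lambda>n. real_of_ereal (g j (v (Suc (s n))))) \<longlonglongrightarrow> real_of_ereal (g j p')"
    by (rule lim_real_of_ereal)
  \<comment> \<open>The limit is stated with \<open>g j p'\<close>: along the subsequence
    \<open>G\<close> equals \<open>g j\<close>, which is continuous on its closed domain.\<close>
  then have obj_lim: "(\<lambda>n. obj (v (Suc (s n)))) \<longlonglongrightarrow> F p' + real_of_ereal (g j p') - H p'"
    unfolding obj_def Gj by (intro tendsto_diff tendsto_add F_tendsto H_tendsto lim')
  \<comment> \<open>A decreasing sequence lies above the limit of any subsequence; this lower bound
    makes all objective values converge.\<close>
  have "F p' + real_of_ereal (g j p') - H p' \<le> obj (v k)" for k
  proof (rule LIMSEQ_le_const2[OF obj_lim])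
    have "obj (v (Suc (s n))) \<le> obj (v k)" if "k \<le> n" for n
      using dec[of k "Suc (s n)"] seq_suble[OF s, of n] that by simp
    then show "\<exists>N. \<forall>n\<ge>N. obj (v (Suc (s n))) \<le> obj (v k)"
      by blast
  qed
  then obtain l where l: "(\<lambda>k. obj (v k)) \<longlonglongrightarrow> l"
    using decseq_convergent[OF \<open>decseq (\<lambda>k. obj (v k))\<close>] by blast
  from tendsto_diff[OF l LIMSEQ_Suc[OF l]]
  have diff: "(\<lambda>k. obj (v k) - obj (v (Suc k))) \<longlonglongrightarrow> 0"
    by simp
  \<comment> \<open>Descent squeezes these terms between 0 and the consecutive differences of a
    convergent sequence.\<close>
  have "(\<lambda>k. c * (norm (v (Suc k) - v k))\<^sup>2) \<longlonglongrightarrow> 0"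
  proof (rule tendsto_sandwich[of "\<lambda>_. 0"])
    show "(\<lambda>k. obj (v k) - obj (v (Suc k))) \<longlonglongrightarrow> 0"
      by (rule diff)
  qed (use c descent_v in auto)
  from LIMSEQ_subseq_LIMSEQ[OF this s]
  have "(\<lambda>n. c * (norm (v (Suc (s n)) - v (s n)))\<^sup>2) \<longlonglongrightarrow> 0"
    by (simp add: comp_def)
  moreover have "(\<lambda>n. c * (norm (v (Suc (s n)) - v (s n)))\<^sup>2) \<longlonglongrightarrow> c * (norm (p' - p))\<^sup>2"
    by (intro tendsto_intros lim lim')
  ultimately have "c * (norm (p' - p))\<^sup>2 = 0"
    using LIMSEQ_unique by blast
  then have "p' = p"
    using c by simp
  then have "p \<in> Fix T"
    using step_via_limit[OF via_s lim lim'] by (auto simp: Fix_def T_iff_step_via)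
  moreover have "accumulation_point w p"
    unfolding accumulation_point_def
    \<comment> \<open>\<open>Suc (s n)\<close> accounts for the shift
      \<open>v k = w (Suc k)\<close>.\<close>
    using lim s by (intro exI[of _ "\<lambda>n. Suc (s n)"]) (simp add: strict_mono_def comp_def v_def)
  ultimately show ?thesis by blast
qed

section \<open>Contraction near the fixed point and convergence\<close>

text \<open>\<open>\<kappa>\<close> is left open to serve both cases. The bound on
  \<open>shift\<close> is asked only where \<open>h m\<close> is active at \<open>x\<close> and at
  \<open>p\<close>, since for \<open>H = 0\<close> the gradient of \<open>h m\<close> is known to
  vanish only at active points.\<close>

lemma local_contraction:
  assumes T: "T p = {p}" and \<rho>: "0 \<le> \<rho>"
    and shift: "\<And>i m x. i \<in> I \<Longrightarrow> m \<in> M \<Longrightarrow> H x = h m x \<Longrightarrow> H p = h m p \<Longrightarrow>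
      norm (shift i m x - shift i m p) \<le> \<kappa> * norm (x - p)"
  shows "\<exists>\<delta>>0. \<forall>x z. norm (x - p) < \<delta> \<longrightarrow> z \<in> T x \<longrightarrow>
    (1 + lam * \<rho>) * norm (z - p) \<le> \<kappa> * norm (x - p)" (is "\<exists>\<delta>>0. ?contraction \<delta>")
proof (rule ccontr)
  assume "\<not> ?thesis"
  then have "\<not> ?contraction (1 / real (Suc n))" for n
    by (metis of_nat_0_less_iff zero_less_Suc zero_less_divide_1_iff)
  then have "\<forall>n. \<exists>x z. norm (x - p) < 1 / real (Suc n) \<and> z \<in> T x \<and>
      \<not> (1 + lam * \<rho>) * norm (z - p) \<le> \<kappa> * norm (x - p)"
    by blast
  then obtain x z where x: "\<And>n. norm (x n - p) < 1 / real (Suc n)" and z: "\<And>n. z n \<in> T (x n)"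
    and bad: "\<And>n. \<not> (1 + lam * \<rho>) * norm (z n - p) \<le> \<kappa> * norm (x n - p)"
    by metis
  obtain i j m and r :: "nat \<Rightarrow> nat" where r: "strict_mono r"
    and via: "\<And>n. step_via i j m (x (r n)) (z (r n))"
    using step_via_subseq[of z x, OF z] by metis
  then have ijm: "i \<in> I" "j \<in> J" "m \<in> M"
    unfolding step_via_def by blast+
  have prox_j: "z \<in> prox lam (g j) (shift i m x)" if "step_via i j m x z" for x z
    using that unfolding step_via_def by (auto intro: prox_mono min_fun_le J)
  have contr: "(1 + lam * \<rho>) * norm (z1 - z2) \<le> norm (shift i m x1 - shift i m x2)"
    if "step_via i j m x1 z1" "step_via i j m x2 z2" for x1 x2 z1 z2
    using prox_contraction[OF g_proper[OF ijm(2)] g_conv[OF ijm(2)] lam(1)] prox_j that by blast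
  have "(\<lambda>n. x n - p) \<longlonglongrightarrow> 0"
    using x by (intro LIMSEQ_norm_0) (auto intro: less_imp_le)
  then have "x \<longlonglongrightarrow> p"
    by (simp add: LIM_zero_iff)
  then have xr: "(\<lambda>n. x (r n)) \<longlonglongrightarrow> p"
    using LIMSEQ_subseq_LIMSEQ[OF _ r] by (simp add: comp_def)
  \<comment> \<open>The end points come with no limit of their own; since steps with equal indices
    contract, they inherit the Cauchy property from the convergent prox arguments.\<close>
  have "Cauchy (\<lambda>n. z (r n))"
  proof (rule metric_CauchyI)
    fix e :: real
    assume "0 < e"
    then obtain N where N: "\<And>a b. N \<le> a \<Longrightarrow> N \<le> b \<Longrightarrow> dist (shift i m (x (r a))) (shift i m (x (r b))) < e"
      using metric_CauchyD[OF LIMSEQ_imp_Cauchy[OF shift_tendsto[OF ijm(1,3) xr]]] by blast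
    have "dist (z (r a)) (z (r b)) < e" if "N \<le> a" "N \<le> b" for a b
    proof -
      have "1 * norm (z (r a) - z (r b)) \<le> (1 + lam * \<rho>) * norm (z (r a) - z (r b))"
        using \<rho> lam(1) by (intro mult_right_mono) auto
      also have "\<dots> \<le> norm (shift i m (x (r a)) - shift i m (x (r b)))"
        by (rule contr[OF via via])
      also have "\<dots> < e"
        using N[OF that] by (simp add: dist_norm)
      finally show ?thesis by (simp add: dist_norm)
    qed
    then show "\<exists>N. \<forall>a\<ge>N. \<forall>b\<ge>N. dist (z (r a)) (z (r b)) < e"
      by blast
  qed
  then obtain q where "(\<lambda>n. z (r n)) \<longlonglongrightarrow> q"
    using Cauchy_convergent convergent_def by blast
  with via xr have q: "step_via i j m p q"
    by (rule step_via_limit)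
  then have "q \<in> T p"
    using T_iff_step_via by blast
  \<comment> \<open>Single-valuedness forces \<open>q = p\<close>, so \<open>p\<close> is a step
    from itself with the very indices of the sequence.\<close>
  with T q have p: "step_via i j m p p"
    by simp
  \<comment> \<open>One term of the subsequence already contradicts \<open>bad\<close>.\<close>
  have "(1 + lam * \<rho>) * norm (z (r 0) - p) \<le> norm (shift i m (x (r 0)) - shift i m p)"
    by (rule contr[OF via p])
  also have "\<dots> \<le> \<kappa> * norm (x (r 0) - p)"
    using via[of 0] p ijm by (intro shift) (auto simp: step_via_def)
  finally show False
    using bad by blast
qed

lemma convergence:
  assumes w: "\<And>k. w (Suc k) \<in> T (w k)"
    and p: "p \<in> Fix T" "is_singleton (T p)" "accumulation_point w p" and \<rho>: "0 \<le> \<rho>"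
    and \<kappa>: "0 \<le> \<kappa>" "\<kappa> \<le> 1 + lam * \<rho>"
    and shift: "\<And>i m x. i \<in> I \<Longrightarrow> m \<in> M \<Longrightarrow> H x = h m x \<Longrightarrow> H p = h m p \<Longrightarrow>
      norm (shift i m x - shift i m p) \<le> \<kappa> * norm (x - p)"
  shows "w \<longlonglongrightarrow> p" "\<kappa> < 1 + lam * \<rho> \<Longrightarrow> Q_linear_convergence w p"
proof -
  have pos: "0 < 1 + lam * \<rho>"
    using \<rho> lam(1) by (simp add: add_pos_nonneg)
  have "T p = {p}"
    using p(1,2) by (auto simp: Fix_def is_singleton_def)
  then have "\<exists>\<delta>>0. \<forall>x z. norm (x - p) < \<delta> \<longrightarrow> z \<in> T x \<longrightarrow>
      (1 + lam * \<rho>) * norm (z - p) \<le> \<kappa> * norm (x - p)"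
    by (intro local_contraction \<rho> shift)
  then obtain \<delta> where \<delta>: "0 < \<delta>"
    "\<And>x z. norm (x - p) < \<delta> \<Longrightarrow> z \<in> T x \<Longrightarrow> (1 + lam * \<rho>) * norm (z - p) \<le> \<kappa> * norm (x - p)"
    by blast
  \<comment> \<open>The local rate is the Lipschitz constant of the forward step over that gained by
    the prox.\<close>
  have "norm (w (Suc k) - p) \<le> \<kappa> / (1 + lam * \<rho>) * norm (w k - p)" if "norm (w k - p) < \<delta>" for k
    using \<delta>(2)[OF that w] pos by (simp add: field_simps)
  note * = accumulation_point_local_contraction[OF p(3) \<delta>(1) _ _ this]
  show "w \<longlonglongrightarrow> p"
    using *(1) \<kappa> pos by simp
  show "Q_linear_convergence w p" if "\<kappa> < 1 + lam * \<rho>"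
    using *(2) that \<kappa> pos unfolding Q_linear_convergence_def
    by (intro exI[of _ "\<kappa> / (1 + lam * \<rho>)"]) simp
qed

text \<open>The gradient step in \<open>f i\<close> contributes 1 and \<open>lam\<close> times the
  gradient of \<open>h m\<close> contributes \<open>lam\<close>.\<close>

lemma shift_lipschitz:
  assumes "nonexpansive (\<lambda>x. x - lam *\<^sub>R grad (f i) x)" "nonexpansive (grad (h m))"
  shows "norm (shift i m x - shift i m p) \<le> (1 + lam) * norm (x - p)"
proof -
  have "norm ((x - lam *\<^sub>R grad (f i) x) - (p - lam *\<^sub>R grad (f i) p)) \<le> norm (x - p)"
    using lipschitz_onD[of 1 UNIV "\<lambda>x. x - lam *\<^sub>R grad (f i) x" x p] assms(1)
    by (simp add: nonexpansive_def dist_norm)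
  moreover have "norm (lam *\<^sub>R (grad (h m) x - grad (h m) p)) \<le> lam * norm (x - p)"
    using lipschitz_onD[of 1 UNIV "grad (h m)" x p] assms(2) lam(1)
    by (auto simp: nonexpansive_def dist_norm)
  moreover have "shift i m x - shift i m p = ((x - lam *\<^sub>R grad (f i) x) - (p - lam *\<^sub>R grad (f i) p))
      + lam *\<^sub>R (grad (h m) x - grad (h m) p)"
    by (simp add: shift_def algebra_simps)
  ultimately show ?thesis
    using norm_triangle_mono[of "(x - lam *\<^sub>R grad (f i) x) - (p - lam *\<^sub>R grad (f i) p)"]
    by (simp add: distrib_right)
qed

lemma shift_nonexpansive_if_H_0:
  assumes "nonexpansive (\<lambda>x. x - lam *\<^sub>R grad (f i) x)" "m \<in> M" "\<And>x. H x = 0" "h m x = 0" "h m p = 0"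
  shows "norm (shift i m x - shift i m p) \<le> norm (x - p)"
proof -
  \<comment> \<open>\<open>h m \<le> H = 0\<close>, so \<open>h m\<close> attains its maximum at every point where it is active.\<close>
  have "h m y \<le> 0" for y
    using le_max_fun[OF M(1) assms(2), of h y] assms(3) by simp
  then have "grad (h m) y = 0" if "h m y = 0" for y
    using grad_eq_0_at_max[OF GDERIV_grad[OF h_diff[OF assms(2)]], of y] that by simp
  then have "grad (h m) x = 0" "grad (h m) p = 0"
    using assms(4,5) by blast+
  then show ?thesis
    using lipschitz_onD[of 1 UNIV "\<lambda>x. x - lam *\<^sub>R grad (f i) x" x p] assms(1)
    by (simp add: nonexpansive_def dist_norm shift_def)
qed

end

theorem theorem5p7:
  fixes I :: "'i set" and J :: "'j set" and M :: "'m set"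
    and f :: "'i \<Rightarrow> 'a::euclidean_space \<Rightarrow> real"
    and g :: "'j \<Rightarrow> 'a \<Rightarrow> ereal"
    and h :: "'m \<Rightarrow> 'a \<Rightarrow> real"
    and L :: "'i \<Rightarrow> real"
    and \<rho> lam :: real
    and w :: "nat \<Rightarrow> 'a"
  assumes "finite I" "I \<noteq> {}" "finite J" "J \<noteq> {}" "finite M" "M \<noteq> {}"
    and "\<And>i. i \<in> I \<Longrightarrow> L i > 0"
    and "\<And>i. i \<in> I \<Longrightarrow> f i differentiable_on UNIV"
    and "\<And>i. i \<in> I \<Longrightarrow> (L i)-lipschitz_on UNIV (grad (f i))"
    and "\<And>j. j \<in> J \<Longrightarrow> proper (g j)"
    and "\<And>j. j \<in> J \<Longrightarrow> rho_convex \<rho> (g j)"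
    and "\<And>j. j \<in> J \<Longrightarrow> closed (effective_domain (g j))"
    and "\<And>j. j \<in> J \<Longrightarrow> continuous_on (effective_domain (g j)) (g j)"
    and "\<And>m. m \<in> M \<Longrightarrow> h m differentiable_on UNIV"
    and "\<And>m. m \<in> M \<Longrightarrow> continuous_on UNIV (grad (h m))"
    and "\<And>m. m \<in> M \<Longrightarrow> convex_on UNIV (h m)"
    and "\<And>i j m. i \<in> I \<Longrightarrow> j \<in> J \<Longrightarrow> m \<in> M \<Longrightarrow>
           coercive (\<lambda>x. ereal (f i x) + g j x - ereal (h m x))"
    and "0 < lam" "lam < 1 / (MAX i\<in>I. L i)"
    and "\<And>k. w (Suc k) \<in> T_PDMC lam I f J g M h (w k)"
  shows "(\<exists>p. p \<in> Fix (T_PDMC lam I f J g M h) \<and> accumulation_point w p) \<and>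
    (\<forall>p. p \<in> Fix (T_PDMC lam I f J g M h) \<longrightarrow> accumulation_point w p \<longrightarrow>
      (\<forall>i\<in>I. nonexpansive (\<lambda>x. x - lam *\<^sub>R grad (f i) x)) \<longrightarrow>
      is_singleton (T_PDMC lam I f J g M h p) \<longrightarrow>
      ((\<forall>m\<in>M. nonexpansive (grad (h m))) \<and> \<rho> \<ge> 1 \<longrightarrow>
         w \<longlonglongrightarrow> p \<and> (\<rho> > 1 \<longrightarrow> Q_linear_convergence w p)) \<and>
      ((\<forall>x. max_fun M h x = 0) \<and> \<rho> \<ge> 0 \<longrightarrow>
         w \<longlonglongrightarrow> p \<and> (\<rho> > 0 \<longrightarrow> Q_linear_convergence w p)))"
proof -
  interpret pdmc I J M f g h L \<rho> lam
    by unfold_locales (fact assms)+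
  note w = assms(20)
  show ?thesis
  proof (intro conjI allI impI)
    show "\<exists>p. p \<in> Fix T \<and> accumulation_point w p"
      using ex_fixed_accumulation_point[of w, OF w] .
  next
    fix p
    assume p: "p \<in> Fix T" "accumulation_point w p" "is_singleton (T p)"
      and f: "\<forall>i\<in>I. nonexpansive (\<lambda>x. x - lam *\<^sub>R grad (f i) x)"
      and h: "(\<forall>m\<in>M. nonexpansive (grad (h m))) \<and> \<rho> \<ge> 1"
    \<comment> \<open>Here \<open>\<kappa> = 1 + lam\<close>, so \<open>\<rho> \<ge> 1\<close> makes
      the rate at most 1, and \<open>\<rho> > 1\<close> makes it smaller than 1.\<close>
    have "lam * 1 \<le> lam * \<rho>"
      using h assms(18) by (intro mult_left_mono) auto
    then have "1 + lam \<le> 1 + lam * \<rho>"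
      by simp
    note * = convergence[of w, OF w p(1,3,2) _ _ this shift_lipschitz]
    show "w \<longlonglongrightarrow> p"
      using *(1) f h assms(18) by simp
    show "Q_linear_convergence w p" if "\<rho> > 1"
      using *(2) f h assms(18) that by simp
  next
    fix p
    assume p: "p \<in> Fix T" "accumulation_point w p" "is_singleton (T p)"
      and f: "\<forall>i\<in>I. nonexpansive (\<lambda>x. x - lam *\<^sub>R grad (f i) x)"
      and h: "(\<forall>x. H x = 0) \<and> \<rho> \<ge> 0"
    \<comment> \<open>Here \<open>\<kappa> = 1\<close>, so \<open>\<rho> \<ge> 0\<close> suffices
      for convergence and \<open>\<rho> > 0\<close> for a linear rate.\<close>
    have "norm (shift i m x - shift i m p) \<le> 1 * norm (x - p)"
      if "i \<in> I" "m \<in> M" "H x = h m x" "H p = h m p" for i m x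
      using shift_nonexpansive_if_H_0[of i m x p] f h that by simp
    note * = convergence[of w, OF w p(1,3,2) _ _ _ this]
    show "w \<longlonglongrightarrow> p"
      using *(1) h assms(18) by simp
    show "Q_linear_convergence w p" if "\<rho> > 0"
      using *(2) h assms(18) that by simp
  qed
qed

end
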